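(* Let $\alpha\in[-1/2,1)$, $\zeta\in\mathbb{C}$ with $|\zeta|\le1$, and let $f=h+\overline{g}\in\mathcal{M}(\alpha,\zeta,1)$. Then $$|T_{3}(1)[h]|\leq \begin{cases}\frac{1}{9}\left(8\alpha^4-34\alpha^3+71\alpha^2-72\alpha+36\right) & \left(-\frac12\le\alpha\le\frac12\right),\\[4pt] \frac{1}{9}\left(-2\alpha^3+25\alpha^2-44\alpha+30\right) & \left(\frac12\le\alpha<1\right),\end{cases}$$ and $$|T_{3}(1)[g]|\leq\frac13(1-\alpha).$$ The first inequality is sharp: equality is attained by the function $h(z)=\int_0^z\frac{dt}{(1-\delta t)^{2-2\alpha}}$ for suitable $\delta$ with $|\delta|=1$. The second inequality is sharp: equality is attained by the function $g(z)=\int_0^z\frac{\zeta t}{(1-\delta t)^{2-2\alpha}}\,dt$ for suitable $\delta,\zeta$ with $|\delta|=1$, $|\zeta|\le1$.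
   Context: $\mathbb{D}=\{z\in\mathbb{C}:|z|<1\}$. $\mathcal{H}$ is the class of sense-preserving harmonic mappings $f=h+\overline{g}$ in $\mathbb{D}$ (i.e. $|h'|>|g'|$ in $\mathbb{D}$), where $h(z)=z+\sum_{k=2}^\infty a_kz^k$ and $g(z)=\sum_{k=1}^\infty b_kz^k$ are analytic in $\mathbb{D}$; put $a_1=1$. For $-1/2\le\alpha<1$, $\mathcal{K}(\alpha)$ is the class of analytic functions $h$ in $\mathbb{D}$ with $h(0)=h'(0)-1=0$ and $\operatorname{Re}\left(1+\frac{zh''(z)}{h'(z)}\right)>\alpha$ for $z\in\mathbb{D}$. For $\alpha\in[-1/2,1)$ and $\zeta\in\mathbb{C}$ with $|\zeta|\le1$, $\mathcal{M}(\alpha,\zeta,1)$ is the class of $f=h+\overline{g}\in\mathcal{H}$ such that $h\in\mathcal{K}(\alpha)$ and $g'(z)=\zeta z\,h'(z)$ in $\mathbb{D}$. For an analytic function $F(z)=\sum_{k\ge1}c_kz^k$, the symmetric Toeplitz determinant $T_q(n)[F]$ ($q,n\in\mathbb{N}$) is the determinant of the $q\times q$ matrix whose $(i,j)$ entry is $c_{n+|i-j|}$. Thus $T_3(1)[h]=\begin{vmatrix} 1 & a_2 & a_3 \\ {} a_2 & 1 & a_2 \\ {} a_3 & a_2 & 1 \end{vmatrix}$ and $T_3(1)[g]=\begin{vmatrix} b_1 & b_2 & b_3 \\ {} b_2 & b_1 & b_2 \\ {} b_3 & b_2 & b_1 \end{vmatrix}$.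
   Formalization: Sharpness of the first inequality is asserted only for −1/2 ≤ α ≤ 1/2: for 1/2 < α < 1 the displayed h never attains the bound (at α = 3/4, |T₃(1)[h]| ≤ 1.125 for every δ, while the bound is about 1.1354). *)

theory Defs
  imports
    "HOL-Complex_Analysis.Complex_Analysis"
    "Jordan_Normal_Form.Determinant"
begin

abbreviation unit_disc :: "complex set" where
  "unit_disc \<equiv> ball 0 1"

text \<open>
  Mappings are total functions on the complex plane; only their values on the unit disc matter.
  The normalization \<open>g 0 = 0\<close> makes the pair \<open>(h, g)\<close> unique on the disc.
\<close>
definition harmonic_decomp ::
    "(complex \<Rightarrow> complex) \<Rightarrow> (complex \<Rightarrow> complex) \<Rightarrow> (complex \<Rightarrow> complex) \<Rightarrow> bool" where
  "harmonic_decomp f h g \<longleftrightarrow>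
     h holomorphic_on unit_disc \<and> g holomorphic_on unit_disc \<and>
     h 0 = 0 \<and> deriv h 0 = 1 \<and> g 0 = 0 \<and>
     (\<forall>z\<in>unit_disc. f z = h z + cnj (g z))"

definition class_H :: "(complex \<Rightarrow> complex) set" where
  "class_H = {f. \<exists>h g. harmonic_decomp f h g \<and>
     (\<forall>z\<in>unit_disc. cmod (deriv h z) > cmod (deriv g z))}"

text \<open>
  The condition \<open>deriv h z \<noteq> 0\<close> is the well-definedness of the quotient, which has to be
  made explicit because of the convention \<open>x / 0 = 0\<close>.
\<close>
definition class_K :: "real \<Rightarrow> (complex \<Rightarrow> complex) set" where
  "class_K \<alpha> = {h. h holomorphic_on unit_disc \<and> h 0 = 0 \<and> deriv h 0 = 1 \<and>
     (\<forall>z\<in>unit_disc. deriv h z \<noteq> 0 \<and>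
        Re (1 + z * deriv (deriv h) z / deriv h z) > \<alpha>)}"

text \<open>The class \<open>\<M>(\<alpha>, \<zeta>, 1)\<close>.\<close>
definition class_M1 :: "real \<Rightarrow> complex \<Rightarrow> (complex \<Rightarrow> complex) set" where
  "class_M1 \<alpha> \<zeta> = {f \<in> class_H. \<exists>h g. harmonic_decomp f h g \<and> h \<in> class_K \<alpha> \<and>
     (\<forall>z\<in>unit_disc. deriv g z = \<zeta> * z * deriv h z)}"

text \<open>Matrix indices start at 0, which does not affect \<open>\<bar>i - j\<bar>\<close>.\<close>
definition toeplitz_det :: "nat \<Rightarrow> nat \<Rightarrow> (complex \<Rightarrow> complex) \<Rightarrow> complex" where
  "toeplitz_det q n F =
     Determinant.det (Matrix.mat q q
       (\<lambda>(i, j). fps_nth (fps_expansion F 0) (n + nat \<bar>int i - int j\<bar>)))"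

text \<open>
  On the unit disc, \<open>1 - \<delta> * t\<close> with \<open>\<bar>\<delta>\<bar> = 1\<close> has positive real part, so that the
  principal power used here is holomorphic there.
\<close>
definition extremal_h :: "real \<Rightarrow> complex \<Rightarrow> complex \<Rightarrow> complex" where
  "extremal_h \<alpha> \<delta> z = contour_integral (linepath 0 z)
     (\<lambda>t. 1 / (1 - \<delta> * t) powr complex_of_real (2 - 2 * \<alpha>))"

definition extremal_g :: "real \<Rightarrow> complex \<Rightarrow> complex \<Rightarrow> complex \<Rightarrow> complex" where
  "extremal_g \<alpha> \<zeta> \<delta> z = contour_integral (linepath 0 z)
     (\<lambda>t. \<zeta> * t / (1 - \<delta> * t) powr complex_of_real (2 - 2 * \<alpha>))"

end

theory Submission
  imports Defs
begin

text \<open>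
  Put \<open>b = 1 - \<alpha> > 0\<close>. The condition \<open>Re (z h'' / h') > - b\<close> means that
  \<open>z h'' / h' = 2 b w / (1 - w)\<close> for a Schwarz function \<open>w z = z \<phi> z\<close>, where \<open>\<phi>\<close> is
  holomorphic with \<open>\<bar>\<phi>\<bar> \<le> 1\<close> (\<open>class_K_subordination\<close>). Comparing Taylor coefficients,

  \<open>a2 = b \<phi>(0)\<close> and \<open>a3 = b / 3 (\<phi>'(0) + (1 + 2 b) \<phi>(0)\<^sup>2)\<close>,

  so that \<open>a3 - 2 a2\<^sup>2 = b / 3 (\<phi>'(0) + (1 - 4 b) \<phi>(0)\<^sup>2)\<close>. With the Schwarz-Pick inequality
  \<open>\<bar>\<phi>'(0)\<bar> \<le> 1 - \<bar>\<phi>(0)\<bar>\<^sup>2\<close> (\<open>norm_deriv_0_le_of_norm_le_1\<close>) this gives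

  \<open>\<bar>a2\<bar> \<le> b\<close>, \<open>\<bar>a3\<bar> \<le> b (1 + 2 b) / 3\<close> and \<open>\<bar>a3 - 2 a2\<^sup>2\<bar> \<le> b / 3 max 1 \<bar>1 - 4 b\<bar>\<close>.

  The first determinant is \<open>1 - 2 a2\<^sup>2 + a3 (2 a2\<^sup>2 - a3)\<close>, and the triangle inequality yields
  both of its bounds; the two cases are the two values of the maximum. From \<open>g' = \<zeta> z h'\<close> follow
  \<open>b1 = 0\<close>, \<open>b2 = \<zeta> / 2\<close> and \<open>b3 = 2 \<zeta> a2 / 3\<close>, so the second determinant is
  \<open>2 b2\<^sup>2 b3 = \<zeta>\<^sup>3 a2 / 3\<close> (\<open>toeplitz_det_of_subordination\<close>).

  The extremal functions belong to \<open>\<phi> = \<delta>\<close>, that is \<open>a2 = b \<delta>\<close> and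
  \<open>a3 = b (1 + 2 b) \<delta>\<^sup>2 / 3\<close>. For \<open>\<delta> = \<i>\<close> and \<open>b \<ge> 1/2\<close> all terms of the first determinant are
  nonnegative, and equality holds in the triangle inequality; \<open>\<delta> = \<zeta> = 1\<close> is extremal for the
  second one.

  A harmonic mapping determines its parts \<open>h\<close> and \<open>g\<close> on the disc (\<open>harmonic_decomp_unique\<close>),
  because a holomorphic function that is also antiholomorphic is constant.
\<close>

section \<open>Functions bounded by one on the unit disc\<close>

text \<open>
  The Schwarz-Pick inequality at the origin. The weak bound \<open>\<le> 1\<close> in the hypothesis
  matters: for rotations of the extremal function, \<open>\<phi>\<close> is a unimodular constant.
\<close>
lemma norm_deriv_0_le_of_norm_le_1:
  assumes hol: "\<phi> holomorphic_on unit_disc"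
    and le: "\<And>z. cmod z < 1 \<Longrightarrow> cmod (\<phi> z) \<le> 1"
  shows "cmod (deriv \<phi> 0) \<le> 1 - (cmod (\<phi> 0))\<^sup>2"
proof (cases "\<exists>w. cmod w < 1 \<and> cmod (\<phi> w) = 1")
  case True
  then obtain w where w: "cmod w < 1" "cmod (\<phi> w) = 1" by blast
  have "\<phi> constant_on unit_disc"
    using hol w le
    by (intro maximum_modulus_principle[of _ _ unit_disc w]) auto
  then obtain c where c: "\<And>z. z \<in> unit_disc \<Longrightarrow> \<phi> z = c"
    by (auto simp: constant_on_def)
  have "deriv \<phi> 0 = deriv (\<lambda>_. c) 0"
    by (rule deriv_cong_ev)
      (auto intro!: eventually_nhds_in_open[THEN eventually_mono, of unit_disc] c)
  moreover have "cmod (\<phi> 0) \<le> 1" using le by simp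
  ultimately show ?thesis by (simp add: power_le_one)
next
  case False
  with le have lt: "cmod (\<phi> z) < 1" if "cmod z < 1" for z
    using that by (meson order_le_less)
  define a where "a = \<phi> 0"
  define \<psi> where "\<psi> = Moebius_function 0 a \<circ> \<phi>"
  have a: "cmod a < 1" using lt by (simp add: a_def)
  have "\<psi> holomorphic_on unit_disc"
    unfolding \<psi>_def
    by (rule holomorphic_on_compose_gen[OF hol Moebius_function_holomorphic[OF a]])
      (use lt in auto)
  moreover have "\<psi> 0 = 0"
    by (simp add: \<psi>_def a_def Moebius_function_eq_zero)
  moreover have "cmod (\<psi> z) < 1" if "cmod z < 1" for z
    using Moebius_function_norm_lt_1[OF a lt[OF that]] by (simp add: \<psi>_def)
  ultimately have le1: "cmod (deriv \<psi> 0) \<le> 1"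
    by (intro Schwarz_Lemma(2)[of \<psi> 0]) auto
  have aa: "1 - cnj a * a = complex_of_real (1 - (cmod a)\<^sup>2)"
    by (simp add: complex_norm_square[symmetric] mult.commute flip: of_real_power)
  have pos: "0 < 1 - (cmod a)\<^sup>2"
    using a by (simp add: power_less_one_iff abs_square_less_1)
  then have nz: "1 - cnj a * \<phi> 0 \<noteq> 0"
    using aa by (simp add: a_def del: of_real_diff)
  have d\<phi>: "(\<phi> has_field_derivative deriv \<phi> 0) (at 0)"
    using hol by (intro holomorphic_derivI[of _ unit_disc]) auto
  have "(\<psi> has_field_derivative deriv \<phi> 0 / (1 - cnj a * a)) (at 0)"
    unfolding \<psi>_def o_def Moebius_function_simple
    by (rule derivative_eq_intros d\<phi> nz refl)+
      (use nz in \<open>simp add: a_def power2_eq_square divide_simps\<close>)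
  then have "deriv \<psi> 0 = deriv \<phi> 0 / complex_of_real (1 - (cmod a)\<^sup>2)"
    by (simp only: DERIV_imp_deriv aa)
  with le1 have "cmod (deriv \<phi> 0) / (1 - (cmod a)\<^sup>2) \<le> 1"
    using pos by (simp add: norm_divide del: of_real_diff)
  then show ?thesis
    using pos by (simp add: a_def)
qed

lemma norm_le_1_of_norm_mult_less_1:
  assumes hol: "\<phi> holomorphic_on unit_disc"
    and lt: "\<And>z. cmod z < 1 \<Longrightarrow> cmod (z * \<phi> z) < 1"
    and z: "cmod z < 1"
  shows "cmod (\<phi> z) \<le> 1"
proof -
  have hol': "(\<lambda>z. z * \<phi> z) holomorphic_on unit_disc"
    by (intro holomorphic_intros hol)
  show ?thesis
  proof (cases "z = 0")
    case True
    have "(\<phi> has_field_derivative deriv \<phi> 0) (at 0)"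
      using hol by (intro holomorphic_derivI[of _ unit_disc]) auto
    then have "((\<lambda>z. z * \<phi> z) has_field_derivative \<phi> 0) (at 0)"
      by (auto intro!: derivative_eq_intros)
    then have "deriv (\<lambda>z. z * \<phi> z) 0 = \<phi> 0"
      by (rule DERIV_imp_deriv)
    then show ?thesis
      using Schwarz_Lemma(2)[OF hol' _ lt z] True by simp
  next
    case False
    then show ?thesis
      using Schwarz_Lemma(1)[OF hol' _ lt z] by (simp add: norm_mult)
  qed
qed

section \<open>Uniqueness of the analytic and co-analytic parts\<close>

lemma deriv_eq_0_of_eq_cnj:
  assumes "u field_differentiable at z" "v field_differentiable at z"
    and ev: "\<forall>\<^sub>F w in nhds z. u w = cnj (v w)"
  shows "deriv u z = 0"
proof -
  define a b where "a = deriv u z" and "b = deriv v z"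
  have "(u has_derivative (\<lambda>x. a * x)) (at z)"
    using assms(1) by (auto simp: a_def DERIV_deriv_iff_field_differentiable[symmetric]
        has_field_derivative_def)
  moreover have "(v has_derivative (\<lambda>x. b * x)) (at z)"
    using assms(2) by (auto simp: b_def DERIV_deriv_iff_field_differentiable[symmetric]
        has_field_derivative_def)
  then have "((\<lambda>w. cnj (v w)) has_derivative (\<lambda>x. cnj (b * x))) (at z)"
    by (rule has_derivative_cnj)
  then have "(u has_derivative (\<lambda>x. cnj (b * x))) (at z)"
    by (rule has_derivative_transform_eventually)
      (use ev eventually_nhds_x_imp_x[OF ev] in
        \<open>auto simp: eventually_at_filter elim: eventually_mono\<close>)
  ultimately have eq: "(\<lambda>x. a * x) = (\<lambda>x. cnj (b * x))"
    by (rule has_derivative_unique)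
  \<comment> \<open>The derivative is both complex linear and complex antilinear.\<close>
  have "a = cnj b" using fun_cong[OF eq, of 1] by simp
  moreover have "a * \<i> = - (cnj b * \<i>)" using fun_cong[OF eq, of \<i>] by simp
  ultimately show ?thesis by (simp add: a_def)
qed

lemma harmonic_decomp_unique:
  assumes "harmonic_decomp f h g" "harmonic_decomp f h' g'" and z: "z \<in> unit_disc"
  shows "h z = h' z" and "g z = g' z"
proof -
  have hol: "h holomorphic_on unit_disc" "g holomorphic_on unit_disc"
      "h' holomorphic_on unit_disc" "g' holomorphic_on unit_disc"
    and 0: "h 0 = 0" "h' 0 = 0"
    and f: "\<And>w. w \<in> unit_disc \<Longrightarrow> h w + cnj (g w) = h' w + cnj (g' w)"
    using assms by (auto simp: harmonic_decomp_def)
  have hold: "(\<lambda>w. h w - h' w) holomorphic_on unit_disc" "(\<lambda>w. g' w - g w) holomorphic_on unit_disc"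
    by (intro holomorphic_intros hol)+
  have "((\<lambda>w. h w - h' w) has_field_derivative 0) (at w within unit_disc)"
    if w: "w \<in> unit_disc" for w
  proof -
    have "deriv (\<lambda>w. h w - h' w) w = 0"
    proof (rule deriv_eq_0_of_eq_cnj)
      show "\<forall>\<^sub>F x in nhds w. h x - h' x = cnj (g' x - g x)"
        using eventually_nhds_in_open[OF _ w]
      proof (rule eventually_mono)
        show "h x - h' x = cnj (g' x - g x)" if "x \<in> unit_disc" for x
        proof -
          have "h x = h' x + cnj (g' x) - cnj (g x)"
            using f[OF that] by (simp add: eq_diff_eq)
          then show ?thesis by simp
        qed
      qed simp
    qed (use hold w holomorphic_on_imp_differentiable_at in auto)
    then show ?thesis
      using holomorphic_derivI[OF hold(1) _ w, of unit_disc] by simp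
  qed
  then have "\<exists>c. \<forall>w\<in>unit_disc. h w - h' w = c"
    by (intro has_field_derivative_zero_constant) auto
  then obtain c where c: "\<And>w. w \<in> unit_disc \<Longrightarrow> h w - h' w = c" by blast
  show "h z = h' z"
    using c[OF z] c[of 0] 0 by simp
  then show "g z = g' z"
    using f[OF z] by simp
qed

section \<open>Toeplitz determinants in terms of the Schwarz function\<close>

lemma det_mat_2:
  fixes f :: "nat \<times> nat \<Rightarrow> 'a :: comm_ring_1"
  shows "Determinant.det (Matrix.mat 2 2 f) = f (0, 0) * f (1, 1) - f (0, 1) * f (1, 0)"
proof -
  have A: "Matrix.mat 2 2 f \<in> carrier_mat 2 2" by simp
  have 1: "Determinant.det B = B $$ (0, 0)" if "B \<in> carrier_mat (Suc 0) (Suc 0)" for B :: "'a mat"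
    using that det_single[of B] by simp
  show ?thesis
    by (subst laplace_expansion_row[OF A, of 0])
      (simp_all add: numeral_2_eq_2 cofactor_def mat_delete_def 1)
qed

lemma det_mat_3:
  fixes f :: "nat \<times> nat \<Rightarrow> 'a :: comm_ring_1"
  shows "Determinant.det (Matrix.mat 3 3 f) =
    f (0, 0) * (f (1, 1) * f (2, 2) - f (1, 2) * f (2, 1)) -
    f (0, 1) * (f (1, 0) * f (2, 2) - f (1, 2) * f (2, 0)) +
    f (0, 2) * (f (1, 0) * f (2, 1) - f (1, 1) * f (2, 0))"
proof -
  have A: "Matrix.mat 3 3 f \<in> carrier_mat 3 3" by simp
  have 3: "{..<3} = {0, 1, 2 :: nat}" by auto
  show ?thesis
    by (subst laplace_expansion_row[OF A, of 0])
      (simp_all add: 3 cofactor_def mat_delete_def det_mat_2, simp add: eval_nat_numeral algebra_simps)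
qed

lemma toeplitz_det_3_1:
  fixes F :: "complex \<Rightarrow> complex"
  defines "c \<equiv> fps_nth (fps_expansion F 0)"
  shows "toeplitz_det 3 1 F =
    c 1 ^ 3 - 2 * c 1 * (c 2)\<^sup>2 + 2 * (c 2)\<^sup>2 * c 3 - c 1 * (c 3)\<^sup>2"
  unfolding toeplitz_det_def det_mat_3 c_def[symmetric]
  by (simp add: power2_eq_square power3_eq_cube algebra_simps eval_nat_numeral)

lemma fps_nth_fps_expansion_0:
  "fps_nth (fps_expansion F 0) 1 = deriv F 0"
  "fps_nth (fps_expansion F 0) 2 = deriv (deriv F) 0 / 2"
  "fps_nth (fps_expansion F 0) 3 = deriv (deriv (deriv F)) 0 / 6"
  by (simp_all add: fps_expansion_def eval_nat_numeral)

lemma toeplitz_det_cong: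
  assumes "\<And>z. z \<in> unit_disc \<Longrightarrow> F z = G z"
  shows "toeplitz_det q n F = toeplitz_det q n G"
proof -
  have "\<forall>\<^sub>F z in nhds 0. F z = G z"
    using eventually_nhds_in_open[of unit_disc 0] assms by (auto elim: eventually_mono)
  then show ?thesis
    unfolding toeplitz_det_def by (simp cong: fps_expansion_cong)
qed

lemma deriv_eqI_of_disc:
  assumes "\<And>z. z \<in> unit_disc \<Longrightarrow> u z = v z" and "(v has_field_derivative d) (at 0)"
  shows "deriv u 0 = d"
proof -
  have "\<forall>\<^sub>F z in nhds 0. u z = v z"
    using eventually_nhds_in_open[of unit_disc 0] assms(1) by (auto elim: eventually_mono)
  then have "deriv u 0 = deriv v 0"
    by (rule deriv_cong_ev) simp
  then show ?thesis using assms(2) by (simp add: DERIV_imp_deriv)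
qed

text \<open>
  For real \<open>b\<close> and \<open>\<bar>\<phi>\<bar> \<le> 1\<close>, the differential equation expresses the subordination
  \<open>1 + z h'' / h' \<prec> (1 + (2 b - 1) z) / (1 - z)\<close> with Schwarz function \<open>z \<phi> z\<close>. Only the
  first two Taylor coefficients of \<open>\<phi>\<close> enter.
\<close>
lemma derivs_of_subordination:
  assumes h: "h holomorphic_on unit_disc" "deriv h 0 = 1"
    and \<phi>: "\<phi> holomorphic_on unit_disc"
    and eq: "\<And>z. z \<in> unit_disc \<Longrightarrow>
      deriv (deriv h) z = \<phi> z * (2 * b * deriv h z + z * deriv (deriv h) z)"
  shows "deriv (deriv h) 0 = 2 * b * \<phi> 0"
    and "deriv (deriv (deriv h)) 0 = 2 * b * (deriv \<phi> 0 + (1 + 2 * b) * (\<phi> 0)\<^sup>2)"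
proof -
  show 2: "deriv (deriv h) 0 = 2 * b * \<phi> 0"
    using eq[of 0] h(2) by simp
  have D: "(u has_field_derivative deriv u 0) (at 0)" if "u holomorphic_on unit_disc" for u
    using that by (intro holomorphic_derivI[of _ unit_disc]) auto
  have "((\<lambda>z. \<phi> z * (2 * b * deriv h z + z * deriv (deriv h) z)) has_field_derivative
      \<phi> 0 * (2 * b * deriv (deriv h) 0 + deriv (deriv h) 0) + deriv \<phi> 0 * (2 * b)) (at 0)"
    using h \<phi>
    by (auto intro!: derivative_eq_intros D holomorphic_deriv)
  then have "deriv (deriv (deriv h)) 0 =
      \<phi> 0 * (2 * b * deriv (deriv h) 0 + deriv (deriv h) 0) + deriv \<phi> 0 * (2 * b)"
    by (rule deriv_eqI_of_disc[rotated]) (rule eq)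
  then show "deriv (deriv (deriv h)) 0 = 2 * b * (deriv \<phi> 0 + (1 + 2 * b) * (\<phi> 0)\<^sup>2)"
    by (simp add: 2 power2_eq_square algebra_simps)
qed

lemma derivs_of_dilatation:
  assumes h: "h holomorphic_on unit_disc" "deriv h 0 = 1"
    and g: "g holomorphic_on unit_disc"
    and eq: "\<And>z. z \<in> unit_disc \<Longrightarrow> deriv g z = \<zeta> * z * deriv h z"
  shows "deriv g 0 = 0" "deriv (deriv g) 0 = \<zeta>"
    and "deriv (deriv (deriv g)) 0 = 2 * \<zeta> * deriv (deriv h) 0"
proof -
  have D: "(u has_field_derivative deriv u z) (at z)"
    if "u holomorphic_on unit_disc" "z \<in> unit_disc" for u z
    using that by (intro holomorphic_derivI[of _ unit_disc]) auto
  have D2: "deriv (deriv g) z = \<zeta> * (deriv h z + z * deriv (deriv h) z)"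
    if z: "z \<in> unit_disc" for z
  proof -
    have "((\<lambda>z. \<zeta> * z * deriv h z) has_field_derivative
        \<zeta> * (deriv h z + z * deriv (deriv h) z)) (at z)"
      using h z
      by (auto intro!: derivative_eq_intros D holomorphic_deriv simp: algebra_simps)
    moreover
    have "\<forall>\<^sub>F w in nhds z. deriv g w = \<zeta> * w * deriv h w"
      using eventually_nhds_in_open[OF _ z] eq by (auto elim: eventually_mono)
    then have "deriv (deriv g) z = deriv (\<lambda>z. \<zeta> * z * deriv h z) z"
      by (rule deriv_cong_ev) simp
    ultimately show ?thesis by (simp only: DERIV_imp_deriv)
  qed
  show "deriv g 0 = 0" using eq[of 0] by simp
  show "deriv (deriv g) 0 = \<zeta>" using D2[of 0] h by simp
  have "((\<lambda>z. \<zeta> * (deriv h z + z * deriv (deriv h) z)) has_field_derivative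
      2 * \<zeta> * deriv (deriv h) 0) (at 0)"
    using h by (auto intro!: derivative_eq_intros D holomorphic_deriv)
  then show "deriv (deriv (deriv g)) 0 = 2 * \<zeta> * deriv (deriv h) 0"
    by (rule deriv_eqI_of_disc[rotated]) (rule D2)
qed

text \<open>The numbers \<open>a2\<close> and \<open>a3\<close> are the second and third Taylor coefficients of \<open>h\<close>.\<close>
lemma toeplitz_det_of_subordination:
  assumes h: "h holomorphic_on unit_disc" "deriv h 0 = 1"
    and \<phi>: "\<phi> holomorphic_on unit_disc"
    and eq: "\<And>z. z \<in> unit_disc \<Longrightarrow>
      deriv (deriv h) z = \<phi> z * (2 * b * deriv h z + z * deriv (deriv h) z)"
  defines "a2 \<equiv> b * \<phi> 0"
    and "a3 \<equiv> b * (deriv \<phi> 0 + (1 + 2 * b) * (\<phi> 0)\<^sup>2) / 3"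
  shows "toeplitz_det 3 1 h = 1 - 2 * a2\<^sup>2 + a3 * (2 * a2\<^sup>2 - a3)"
    and "g holomorphic_on unit_disc \<Longrightarrow>
      (\<And>z. z \<in> unit_disc \<Longrightarrow> deriv g z = \<zeta> * z * deriv h z) \<Longrightarrow>
      toeplitz_det 3 1 g = \<zeta> ^ 3 * a2 / 3"
proof -
  have "deriv (deriv h) 0 = 2 * b * \<phi> 0"
    by (rule derivs_of_subordination(1)[OF h \<phi>]) (rule eq)
  moreover have "deriv (deriv (deriv h)) 0 = 2 * b * (deriv \<phi> 0 + (1 + 2 * b) * (\<phi> 0)\<^sup>2)"
    by (rule derivs_of_subordination(2)[OF h \<phi>]) (rule eq)
  ultimately have d: "deriv (deriv h) 0 / 2 = a2" "deriv (deriv (deriv h)) 0 / 6 = a3"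
    by (simp_all add: a2_def a3_def)
  show "toeplitz_det 3 1 h = 1 - 2 * a2\<^sup>2 + a3 * (2 * a2\<^sup>2 - a3)"
    unfolding toeplitz_det_3_1 fps_nth_fps_expansion_0 d h(2)
    by (simp add: power2_eq_square algebra_simps)
  show "toeplitz_det 3 1 g = \<zeta> ^ 3 * a2 / 3"
    if g: "g holomorphic_on unit_disc"
      and eq': "\<And>z. z \<in> unit_disc \<Longrightarrow> deriv g z = \<zeta> * z * deriv h z"
  proof -
    have "deriv g 0 = 0" "deriv (deriv g) 0 = \<zeta>"
      and "deriv (deriv (deriv g)) 0 = 4 * \<zeta> * a2"
      using derivs_of_dilatation[OF h g eq'] by (simp_all flip: d)
    then show ?thesis
      unfolding toeplitz_det_3_1 fps_nth_fps_expansion_0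
      by (simp add: power2_eq_square power3_eq_cube)
  qed
qed

section \<open>Bounds for the class \<open>\<K>(\<alpha>)\<close>\<close>

text \<open>
  The function \<open>\<phi>\<close> is obtained by solving the differential equation for it; \<open>Re (z h'' / h') > - b\<close>
  says that \<open>z h'' / h'\<close> is closer to \<open>0\<close> than to \<open>- 2 b\<close>, hence \<open>\<bar>z \<phi> z\<bar> < 1\<close>.
\<close>
lemma class_K_subordination:
  assumes h: "h \<in> class_K \<alpha>" and "\<alpha> < 1"
  defines "b \<equiv> 1 - \<alpha>"
  obtains \<phi> where "\<phi> holomorphic_on unit_disc" "\<And>z. cmod z < 1 \<Longrightarrow> cmod (\<phi> z) \<le> 1"
    "\<And>z. z \<in> unit_disc \<Longrightarrow>
      deriv (deriv h) z = \<phi> z * (2 * of_real b * deriv h z + z * deriv (deriv h) z)"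
proof -
  have b: "b > 0" using assms by simp
  have hol: "h holomorphic_on unit_disc" and nz: "\<And>z. z \<in> unit_disc \<Longrightarrow> deriv h z \<noteq> 0"
    using h by (auto simp: class_K_def)
  have re: "Re (z * deriv (deriv h) z / deriv h z) > - b" if "z \<in> unit_disc" for z
  proof -
    have "Re (1 + z * deriv (deriv h) z / deriv h z) > \<alpha>"
      using h that by (simp only: class_K_def mem_Collect_eq)
    then show ?thesis by (simp add: b_def)
  qed
  define q where "q z = deriv (deriv h) z / deriv h z" for z
  have hq: "q holomorphic_on unit_disc"
    unfolding q_def by (intro holomorphic_intros holomorphic_deriv hol nz) auto
  have less: "cmod (z * q z) < cmod (2 * of_real b + z * q z)" if "cmod z < 1" for z
  proof (rule power_less_imp_less_base)
    have "- b < Re (z * q z)" using re[of z] that by (simp add: q_def)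
    then have "0 < 4 * b * (b + Re (z * q z))" using b by simp
    then show "(cmod (z * q z))\<^sup>2 < (cmod (2 * of_real b + z * q z))\<^sup>2"
      unfolding cmod_power2 by (simp add: power2_eq_square algebra_simps)
  qed simp
  define \<phi> where "\<phi> z = q z / (2 * of_real b + z * q z)" for z
  have nz': "2 * of_real b + z * q z \<noteq> 0" if "cmod z < 1" for z
    using less[OF that] by (metis norm_not_less_zero norm_zero)
  have h\<phi>: "\<phi> holomorphic_on unit_disc"
    unfolding \<phi>_def by (intro holomorphic_intros hq) (use nz' in auto)
  have "cmod (z * \<phi> z) < 1" if "cmod z < 1" for z
  proof -
    have "cmod (z * \<phi> z) = cmod (z * q z) / cmod (2 * of_real b + z * q z)"
      by (simp add: \<phi>_def norm_mult norm_divide)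
    then show ?thesis
      using less[OF that] by (simp add: nz'[OF that])
  qed
  then have "\<And>z. cmod z < 1 \<Longrightarrow> cmod (\<phi> z) \<le> 1"
    using norm_le_1_of_norm_mult_less_1[OF h\<phi>] by blast
  moreover have "deriv (deriv h) z = \<phi> z * (2 * of_real b * deriv h z + z * deriv (deriv h) z)"
    if "z \<in> unit_disc" for z
  proof -
    have "deriv (deriv h) z = q z * deriv h z"
      using nz[OF that] by (simp add: q_def)
    moreover have "\<phi> z * (2 * of_real b + z * q z) = q z"
      using nz'[of z] that by (simp add: \<phi>_def)
    moreover have "\<phi> z * (2 * of_real b * deriv h z + z * (q z * deriv h z)) =
        \<phi> z * (2 * of_real b + z * q z) * deriv h z"
      by (simp add: algebra_simps)
    ultimately show ?thesis by simp
  qed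
  ultimately show ?thesis using that h\<phi> by blast
qed

text \<open>
  The inequality of Fekete-Szego type behind both \<open>\<bar>a3\<bar>\<close> and \<open>\<bar>a3 - 2 a2\<^sup>2\<bar>\<close>: the left-hand
  side is at most a convex combination of \<open>1\<close> and \<open>\<bar>c\<bar>\<close> with weight \<open>\<bar>u\<bar>\<^sup>2\<close>.
\<close>
lemma norm_add_mult_square_le:
  fixes u v :: complex and c M :: real
  assumes v: "cmod v \<le> 1 - (cmod u)\<^sup>2" and "\<bar>c\<bar> \<le> M" "1 \<le> M"
  shows "cmod (v + of_real c * u\<^sup>2) \<le> M"
proof -
  have "cmod (v + of_real c * u\<^sup>2) \<le> cmod v + \<bar>c\<bar> * (cmod u)\<^sup>2"
    using norm_triangle_ineq[of v "of_real c * u\<^sup>2"] by (simp add: norm_mult norm_power)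
  also have "\<dots> \<le> M * (1 - (cmod u)\<^sup>2) + M * (cmod u)\<^sup>2"
  proof (intro add_mono mult_right_mono)
    have "0 \<le> 1 - (cmod u)\<^sup>2" using v norm_ge_zero[of v] by linarith
    then show "cmod v \<le> M * (1 - (cmod u)\<^sup>2)"
      using v mult_right_mono[OF \<open>1 \<le> M\<close>, of "1 - (cmod u)\<^sup>2"] by simp
  qed (use assms in auto)
  finally show ?thesis by (simp add: algebra_simps)
qed

text \<open>
  The parameter \<open>M\<close> stands for \<open>max 1 \<bar>4 b - 1\<bar>\<close>, which is \<open>4 b - 1\<close> for \<open>b \<ge> 1/2\<close> and \<open>1\<close>
  for \<open>b \<le> 1/2\<close>.
\<close>
lemma class_K_toeplitz_bounds:
  assumes h: "h \<in> class_K \<alpha>" and "\<alpha> < 1" and M: "\<bar>4 * b - 1\<bar> \<le> M" "1 \<le> M"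
    and b_def: "b = 1 - \<alpha>"
  shows "cmod (toeplitz_det 3 1 h) \<le> 1 + 2 * b\<^sup>2 + b\<^sup>2 * (1 + 2 * b) * M / 9"
    and "g holomorphic_on unit_disc \<Longrightarrow>
      (\<And>z. z \<in> unit_disc \<Longrightarrow> deriv g z = \<zeta> * z * deriv h z) \<Longrightarrow> cmod \<zeta> \<le> 1 \<Longrightarrow>
      cmod (toeplitz_det 3 1 g) \<le> b / 3"
proof -
  have b: "b > 0" using assms by simp
  have h': "h holomorphic_on unit_disc" "deriv h 0 = 1"
    using h by (auto simp: class_K_def)
  obtain \<phi> where \<phi>: "\<phi> holomorphic_on unit_disc" "\<And>z. cmod z < 1 \<Longrightarrow> cmod (\<phi> z) \<le> 1"
    and eq: "\<And>z. z \<in> unit_disc \<Longrightarrow>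
      deriv (deriv h) z = \<phi> z * (2 * of_real b * deriv h z + z * deriv (deriv h) z)"
    using class_K_subordination[OF h \<open>\<alpha> < 1\<close>] unfolding b_def by blast
  note pick = norm_deriv_0_le_of_norm_le_1[OF \<phi>]
  define a2 where "a2 = of_real b * \<phi> 0"
  define a3 where "a3 = of_real b * (deriv \<phi> 0 + (1 + 2 * of_real b) * (\<phi> 0)\<^sup>2) / 3"
  have T: "toeplitz_det 3 1 h = 1 - 2 * a2\<^sup>2 + a3 * (2 * a2\<^sup>2 - a3)"
    unfolding a2_def a3_def by (rule toeplitz_det_of_subordination(1)[OF h' \<phi>(1)]) (rule eq)
  have a2: "cmod a2 \<le> b"
    using b \<phi>(2)[of 0] by (simp add: a2_def norm_mult)
  have "cmod (deriv \<phi> 0 + of_real (1 + 2 * b) * (\<phi> 0)\<^sup>2) \<le> 1 + 2 * b"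
    by (rule norm_add_mult_square_le[OF pick]) (use b in auto)
  then have a3: "cmod a3 \<le> b * (1 + 2 * b) / 3"
    using b by (simp add: a3_def norm_mult)
  define X where "X = deriv \<phi> 0 + of_real (1 - 4 * b) * (\<phi> 0)\<^sup>2"
  have X: "cmod X \<le> M"
    unfolding X_def by (rule norm_add_mult_square_le[OF pick]) (use M in auto)
  have "2 * a2\<^sup>2 - a3 = - (of_real (b / 3) * X)"
    by (simp add: a2_def a3_def X_def power2_eq_square field_simps)
  then have "cmod (2 * a2\<^sup>2 - a3) = b / 3 * cmod X"
    using b by (simp only: norm_minus_cancel norm_mult norm_of_real)
  then have a32: "cmod (2 * a2\<^sup>2 - a3) \<le> b * M / 3"
    using b X by simp
  have "cmod (toeplitz_det 3 1 h) \<le> 1 + cmod (2 * a2\<^sup>2) + cmod (a3 * (2 * a2\<^sup>2 - a3))"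
    unfolding T
    using norm_triangle_ineq[of "1 - 2 * a2\<^sup>2" "a3 * (2 * a2\<^sup>2 - a3)"]
      norm_triangle_ineq4[of 1 "2 * a2\<^sup>2"] by simp
  also have "\<dots> = 1 + 2 * (cmod a2)\<^sup>2 + cmod a3 * cmod (2 * a2\<^sup>2 - a3)"
    by (simp add: norm_mult norm_power)
  also have "\<dots> \<le> 1 + 2 * b\<^sup>2 + (b * (1 + 2 * b) / 3) * (b * M / 3)"
    using a2 a3 a32 b by (intro add_mono mult_mono power_mono) auto
  finally show "cmod (toeplitz_det 3 1 h) \<le> 1 + 2 * b\<^sup>2 + b\<^sup>2 * (1 + 2 * b) * M / 9"
    by (simp add: power2_eq_square field_simps)
  show "cmod (toeplitz_det 3 1 g) \<le> b / 3" if g: "g holomorphic_on unit_disc" "cmod \<zeta> \<le> 1"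
    and eq': "\<And>z. z \<in> unit_disc \<Longrightarrow> deriv g z = \<zeta> * z * deriv h z"
  proof -
    have "toeplitz_det 3 1 g = \<zeta> ^ 3 * a2 / 3"
      unfolding a2_def
      by (rule toeplitz_det_of_subordination(2)[OF h' \<phi>(1) _ g(1)]) (fact eq eq')+
    then have "cmod (toeplitz_det 3 1 g) = cmod \<zeta> ^ 3 * cmod a2 / 3"
      by (simp only: norm_mult norm_divide norm_power norm_numeral)
    also have "\<dots> \<le> 1 * b / 3"
      using a2 b g(2) by (intro divide_right_mono mult_mono power_le_one) auto
    finally show ?thesis by simp
  qed
qed

section \<open>The extremal mappings\<close>

lemma contour_integral_linepath_primitive:
  assumes f: "f holomorphic_on unit_disc"
  defines "F \<equiv> \<lambda>z. contour_integral (linepath 0 z) f"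
  shows "F 0 = 0" and "z \<in> unit_disc \<Longrightarrow> (F has_field_derivative f z) (at z)"
proof -
  show "F 0 = 0" by (simp add: F_def)
  obtain G where G: "\<And>x. x \<in> unit_disc \<Longrightarrow> (G has_field_derivative f x) (at x within unit_disc)"
    using holomorphic_convex_primitive'[OF _ _ f] by auto
  have F: "F w = G w - G 0" if "w \<in> unit_disc" for w
    unfolding F_def
    using contour_integral_primitive[OF G, of "linepath 0 w"] that
      closed_segment_subset[of 0 unit_disc w]
    by (auto intro: contour_integral_unique)
  show "(F has_field_derivative f z) (at z)" if z: "z \<in> unit_disc"
  proof -
    have "(G has_field_derivative f z) (at z)"
      using G[OF z] by (simp add: at_within_open[OF z])
    then have "((\<lambda>w. G w - G 0) has_field_derivative f z) (at z)"
      by (auto intro!: derivative_eq_intros)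
    then show ?thesis
      by (rule DERIV_cong_ev[OF refl _ refl, THEN iffD2, rotated])
        (use F in \<open>auto intro!: eventually_nhds_in_open[THEN eventually_mono, OF _ z]\<close>)
  qed
qed

lemma re_1_minus_pos:
  assumes "cmod \<delta> = 1" "z \<in> unit_disc"
  shows "0 < Re (1 - \<delta> * z)"
  using complex_Re_le_cmod[of "\<delta> * z"] assms by (simp add: norm_mult)

lemma one_minus_nonzero:
  assumes "cmod \<delta> = 1" "z \<in> unit_disc"
  shows "1 - \<delta> * z \<noteq> 0"
  using re_1_minus_pos[OF assms] by (metis less_irrefl zero_complex.simps(1))

text \<open>A unimodular \<open>\<delta>\<close>, fixed together with the parameter \<open>\<alpha>\<close> of the class.\<close>
locale extremal_maps =
  fixes \<alpha> :: real and \<delta> :: complex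
  assumes \<alpha>: "\<alpha> < 1" and \<delta>: "cmod \<delta> = 1"
begin

text \<open>The derivative of \<open>extremal_h \<alpha> \<delta>\<close> on the disc.\<close>
definition extremal_deriv :: "complex \<Rightarrow> complex" where
  "extremal_deriv z = 1 / (1 - \<delta> * z) powr complex_of_real (2 - 2 * \<alpha>)"

lemma has_derivative_extremal_deriv:
  assumes z: "z \<in> unit_disc"
  shows "(extremal_deriv has_field_derivative 2 * of_real (1 - \<alpha>) * \<delta> * extremal_deriv z / (1 - \<delta> * z)) (at z)"
proof -
  have re: "0 < Re (1 - \<delta> * z)" using re_1_minus_pos[OF \<delta> z] .
  have nz: "1 - \<delta> * z \<noteq> 0" using one_minus_nonzero[OF \<delta> z] .
  have powr: "extremal_deriv = (\<lambda>z. (1 - \<delta> * z) powr (- complex_of_real (2 - 2 * \<alpha>)))"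
    by (simp add: fun_eq_iff extremal_deriv_def powr_minus divide_inverse del: of_real_diff)
  define s where "s = complex_of_real (2 - 2 * \<alpha>)"
  have s: "2 * complex_of_real (1 - \<alpha>) = s" by (simp add: s_def)
  have "1 - \<delta> * z \<notin> \<real>\<^sub>\<le>\<^sub>0"
    using re complex_nonpos_Reals_iff by fastforce
  then have "((\<lambda>z. (1 - \<delta> * z) powr (- s)) has_field_derivative
      - s * (1 - \<delta> * z) powr (- s - 1) * (- \<delta>)) (at z)"
    by (auto intro!: derivative_eq_intros)
  then show ?thesis
    using nz unfolding powr_diff s by (simp add: powr[folded s_def] mult_ac)
qed

lemma extremal_deriv_nonzero: "z \<in> unit_disc \<Longrightarrow> extremal_deriv z \<noteq> 0"
  using one_minus_nonzero[OF \<delta>, of z] by (simp add: extremal_deriv_def)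

lemma holomorphic_extremal_deriv: "extremal_deriv holomorphic_on unit_disc"
  unfolding holomorphic_on_open[OF open_ball] using has_derivative_extremal_deriv by blast

lemma has_deriv_extremal_h: "z \<in> unit_disc \<Longrightarrow> (extremal_h \<alpha> \<delta> has_field_derivative extremal_deriv z) (at z)"
  using contour_integral_linepath_primitive(2)[OF holomorphic_extremal_deriv]
  by (simp add: extremal_deriv_def[abs_def] extremal_h_def[abs_def])

lemma has_deriv_extremal_g:
  assumes "z \<in> unit_disc"
  shows "(extremal_g \<alpha> \<zeta> \<delta> has_field_derivative \<zeta> * z * extremal_deriv z) (at z)"
proof -
  have "(\<lambda>z. \<zeta> * z * extremal_deriv z) holomorphic_on unit_disc"
    by (intro holomorphic_intros holomorphic_extremal_deriv)
  from contour_integral_linepath_primitive(2)[OF this assms] show ?thesis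
    by (simp add: extremal_deriv_def[abs_def] extremal_g_def[abs_def])
qed

lemmas deriv_extremal_h = DERIV_imp_deriv[OF has_deriv_extremal_h]
lemmas deriv_extremal_g = DERIV_imp_deriv[OF has_deriv_extremal_g]

lemma deriv2_extremal_h:
  assumes z: "z \<in> unit_disc"
  shows "deriv (deriv (extremal_h \<alpha> \<delta>)) z = 2 * of_real (1 - \<alpha>) * \<delta> * extremal_deriv z / (1 - \<delta> * z)"
proof -
  have "\<forall>\<^sub>F w in nhds z. deriv (extremal_h \<alpha> \<delta>) w = extremal_deriv w"
    using eventually_nhds_in_open[OF _ z] deriv_extremal_h by (auto elim: eventually_mono)
  then have "deriv (deriv (extremal_h \<alpha> \<delta>)) z = deriv extremal_deriv z"
    by (rule deriv_cong_ev) simp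
  then show ?thesis using DERIV_imp_deriv[OF has_derivative_extremal_deriv[OF z]] by simp
qed

lemma hol_extremal:
  "extremal_h \<alpha> \<delta> holomorphic_on unit_disc" "extremal_g \<alpha> \<zeta> \<delta> holomorphic_on unit_disc"
  unfolding holomorphic_on_open[OF open_ball] using has_deriv_extremal_h has_deriv_extremal_g by blast+

lemma extremal_0:
  "extremal_h \<alpha> \<delta> 0 = 0" "extremal_g \<alpha> \<zeta> \<delta> 0 = 0" "deriv (extremal_h \<alpha> \<delta>) 0 = 1"
  by (simp_all add: extremal_h_def extremal_g_def deriv_extremal_h extremal_deriv_def)

lemma deriv_extremal_g_eq:
  "z \<in> unit_disc \<Longrightarrow> deriv (extremal_g \<alpha> \<zeta> \<delta>) z = \<zeta> * z * deriv (extremal_h \<alpha> \<delta>) z"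
  by (simp add: deriv_extremal_h deriv_extremal_g)

lemma extremal_h_in_class_K: "extremal_h \<alpha> \<delta> \<in> class_K \<alpha>"
proof -
  have "\<alpha> < Re (1 + z * deriv (deriv (extremal_h \<alpha> \<delta>)) z / deriv (extremal_h \<alpha> \<delta>) z)"
    if z: "z \<in> unit_disc" for z
  proof -
    define u c where "u = 1 - \<delta> * z" and "c = 2 * (1 - \<alpha>)"
    have re: "0 < Re u" using re_1_minus_pos[OF \<delta> z] by (simp add: u_def)
    then have u: "u \<noteq> 0" by auto
    have "cmod (1 - u) < 1" using z \<delta> by (simp add: u_def norm_mult)
    then have "(cmod (1 - u))\<^sup>2 < 1" by (simp add: abs_square_less_1)
    then have "(cmod u)\<^sup>2 < 2 * Re u"
      unfolding cmod_power2 by (simp add: power2_eq_square algebra_simps)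
    \<comment> \<open>Inversion maps the disc \<open>\<bar>1 - u\<bar> < 1\<close> onto the half-plane \<open>Re > 1/2\<close>.\<close>
    then have "1 < 2 * Re (1 / u)"
      using u by (simp add: Re_divide flip: cmod_power2)
    then have "0 < (1 - \<alpha>) * (2 * Re (1 / u) - 1)"
      using \<alpha> by simp
    also have "\<dots> = Re (1 + of_real c * (1 / u - 1)) - \<alpha>"
    proof -
      have "Re (of_real c * w) = c * Re w" for w by simp
      then show ?thesis by (simp only: plus_complex.sel minus_complex.sel one_complex.sel)
          (simp add: c_def algebra_simps)
    qed
    also have "of_real c * (1 / u - 1) =
        z * deriv (deriv (extremal_h \<alpha> \<delta>)) z / deriv (extremal_h \<alpha> \<delta>) z"
    proof -
      have "1 / u - 1 = (1 - u) / u"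
        using u by (simp add: diff_divide_distrib)
      also have "1 - u = z * \<delta>"
        by (simp add: u_def)
      finally have "of_real c * (1 / u - 1) = of_real c * z * \<delta> / u"
        by simp
      moreover have "deriv (deriv (extremal_h \<alpha> \<delta>)) z = of_real c * \<delta> * extremal_deriv z / u"
        unfolding deriv2_extremal_h[OF z] by (simp add: c_def u_def)
      ultimately show ?thesis
        using extremal_deriv_nonzero[OF z] by (simp add: deriv_extremal_h[OF z])
    qed
    finally show ?thesis by simp
  qed
  moreover have "deriv (extremal_h \<alpha> \<delta>) z \<noteq> 0" if "z \<in> unit_disc" for z
    unfolding deriv_extremal_h[OF that] by (rule extremal_deriv_nonzero[OF that])
  ultimately show ?thesis
    unfolding class_K_def using hol_extremal(1) extremal_0 by blast
qed

lemma extremal_in_class_M1: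
  assumes "cmod \<zeta> \<le> 1"
  shows "\<exists>f \<in> class_M1 \<alpha> \<zeta>. harmonic_decomp f (extremal_h \<alpha> \<delta>) (extremal_g \<alpha> \<zeta> \<delta>)"
proof -
  define f where "f z = extremal_h \<alpha> \<delta> z + cnj (extremal_g \<alpha> \<zeta> \<delta> z)" for z
  have f: "harmonic_decomp f (extremal_h \<alpha> \<delta>) (extremal_g \<alpha> \<zeta> \<delta>)"
    by (simp add: harmonic_decomp_def f_def hol_extremal extremal_0)
  have "cmod (deriv (extremal_g \<alpha> \<zeta> \<delta>) z) < cmod (deriv (extremal_h \<alpha> \<delta>) z)"
    if z: "z \<in> unit_disc" for z
  proof -
    have "cmod \<zeta> * cmod z < 1"
      using assms z mult_left_le_one_le[of "cmod z" "cmod \<zeta>"] by simp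
    then show ?thesis
      using extremal_deriv_nonzero[OF z] by (simp add: deriv_extremal_g[OF z] deriv_extremal_h[OF z] norm_mult)
  qed
  then have "f \<in> class_H"
    unfolding class_H_def using f by blast
  then have "f \<in> class_M1 \<alpha> \<zeta>"
    unfolding class_M1_def using f extremal_h_in_class_K deriv_extremal_g_eq by blast
  then show ?thesis using f by blast
qed

text \<open>The extremal function is the case \<open>\<phi> = \<delta>\<close> of the differential equation.\<close>
lemma toeplitz_det_extremal:
  defines "a2 \<equiv> of_real (1 - \<alpha>) * \<delta>"
    and "a3 \<equiv> of_real ((1 - \<alpha>) * (1 + 2 * (1 - \<alpha>)) / 3) * \<delta>\<^sup>2"
  shows "toeplitz_det 3 1 (extremal_h \<alpha> \<delta>) = 1 - 2 * a2\<^sup>2 + a3 * (2 * a2\<^sup>2 - a3)"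
    and "toeplitz_det 3 1 (extremal_g \<alpha> \<zeta> \<delta>) = \<zeta> ^ 3 * a2 / 3"
proof -
  have eq: "deriv (deriv (extremal_h \<alpha> \<delta>)) z = \<delta> *
      (2 * of_real (1 - \<alpha>) * deriv (extremal_h \<alpha> \<delta>) z + z * deriv (deriv (extremal_h \<alpha> \<delta>)) z)"
    if z: "z \<in> unit_disc" for z
  proof -
    have "1 - \<delta> * z \<noteq> 0" using one_minus_nonzero[OF \<delta> z] .
    then show ?thesis
      unfolding deriv2_extremal_h[OF z] deriv_extremal_h[OF z] by (simp add: field_simps)
  qed
  note T = toeplitz_det_of_subordination[OF hol_extremal(1) extremal_0(3) holomorphic_on_const]
  have a3: "a3 = of_real (1 - \<alpha>) * (deriv (\<lambda>_. \<delta>) 0 + (1 + 2 * of_real (1 - \<alpha>)) * \<delta>\<^sup>2) / 3"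
    by (simp add: a3_def)
  show "toeplitz_det 3 1 (extremal_h \<alpha> \<delta>) = 1 - 2 * a2\<^sup>2 + a3 * (2 * a2\<^sup>2 - a3)"
    unfolding a2_def a3 by (rule T(1)) (rule eq)
  show "toeplitz_det 3 1 (extremal_g \<alpha> \<zeta> \<delta>) = \<zeta> ^ 3 * a2 / 3"
    unfolding a2_def
    by (rule T(2)[OF _ hol_extremal(2)]) (fact eq deriv_extremal_g_eq)+
qed

end

section \<open>Sharp bounds for both determinants\<close>

theorem theorem3p2:
  fixes \<alpha> :: real
  assumes "- 1 / 2 \<le> \<alpha>" and "\<alpha> < 1"
  shows
    "(\<forall>\<zeta> f h g. cmod \<zeta> \<le> 1 \<longrightarrow> f \<in> class_M1 \<alpha> \<zeta> \<longrightarrow> harmonic_decomp f h g \<longrightarrow>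
        (\<alpha> \<le> 1 / 2 \<longrightarrow> cmod (toeplitz_det 3 1 h)
            \<le> 1 / 9 * (8 * \<alpha> ^ 4 - 34 * \<alpha> ^ 3 + 71 * \<alpha> ^ 2 - 72 * \<alpha> + 36)) \<and>
        (1 / 2 \<le> \<alpha> \<longrightarrow> cmod (toeplitz_det 3 1 h)
            \<le> 1 / 9 * (- 2 * \<alpha> ^ 3 + 25 * \<alpha> ^ 2 - 44 * \<alpha> + 30)) \<and>
        cmod (toeplitz_det 3 1 g) \<le> 1 / 3 * (1 - \<alpha>)) \<and>
     (\<alpha> \<le> 1 / 2 \<longrightarrow>
        (\<exists>\<delta>. cmod \<delta> = 1 \<and>
           (\<forall>\<zeta>. cmod \<zeta> \<le> 1 \<longrightarrow>
              (\<exists>f \<in> class_M1 \<alpha> \<zeta>. harmonic_decomp f (extremal_h \<alpha> \<delta>) (extremal_g \<alpha> \<zeta> \<delta>))) \<and>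
           cmod (toeplitz_det 3 1 (extremal_h \<alpha> \<delta>))
             = 1 / 9 * (8 * \<alpha> ^ 4 - 34 * \<alpha> ^ 3 + 71 * \<alpha> ^ 2 - 72 * \<alpha> + 36))) \<and>
     (\<exists>\<delta> \<zeta>. cmod \<delta> = 1 \<and> cmod \<zeta> \<le> 1 \<and>
        (\<exists>f \<in> class_M1 \<alpha> \<zeta>. harmonic_decomp f (extremal_h \<alpha> \<delta>) (extremal_g \<alpha> \<zeta> \<delta>)) \<and>
        cmod (toeplitz_det 3 1 (extremal_g \<alpha> \<zeta> \<delta>)) = 1 / 3 * (1 - \<alpha>))"
proof (intro conjI allI impI)
  fix \<zeta> f h g
  assume \<zeta>: "cmod \<zeta> \<le> 1" and f: "f \<in> class_M1 \<alpha> \<zeta>" and fhg: "harmonic_decomp f h g"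
  obtain h0 g0 where 0: "harmonic_decomp f h0 g0" "h0 \<in> class_K \<alpha>"
    and g0: "\<And>z. z \<in> unit_disc \<Longrightarrow> deriv g0 z = \<zeta> * z * deriv h0 z"
    using f unfolding class_M1_def by blast
  have hg: "toeplitz_det 3 1 h = toeplitz_det 3 1 h0" "toeplitz_det 3 1 g = toeplitz_det 3 1 g0"
    using harmonic_decomp_unique[OF fhg 0(1)] by (auto intro!: toeplitz_det_cong)
  note bounds = class_K_toeplitz_bounds[OF 0(2) assms(2) _ _ refl]
  show "cmod (toeplitz_det 3 1 h)
      \<le> 1 / 9 * (8 * \<alpha> ^ 4 - 34 * \<alpha> ^ 3 + 71 * \<alpha> ^ 2 - 72 * \<alpha> + 36)" if "\<alpha> \<le> 1 / 2"
  proof -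
    have "cmod (toeplitz_det 3 1 h0) \<le> 1 + 2 * (1 - \<alpha>)\<^sup>2
        + (1 - \<alpha>)\<^sup>2 * (1 + 2 * (1 - \<alpha>)) * (4 * (1 - \<alpha>) - 1) / 9"
      by (rule bounds(1)) (use that in auto)
    also have "\<dots> = 1 / 9 * (8 * \<alpha> ^ 4 - 34 * \<alpha> ^ 3 + 71 * \<alpha> ^ 2 - 72 * \<alpha> + 36)"
      by (simp add: field_simps power2_eq_square power3_eq_cube power4_eq_xxxx)
    finally show ?thesis by (simp only: hg)
  qed
  show "cmod (toeplitz_det 3 1 h) \<le> 1 / 9 * (- 2 * \<alpha> ^ 3 + 25 * \<alpha> ^ 2 - 44 * \<alpha> + 30)"
    if "1 / 2 \<le> \<alpha>"
  proof -
    have "cmod (toeplitz_det 3 1 h0) \<le> 1 + 2 * (1 - \<alpha>)\<^sup>2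
        + (1 - \<alpha>)\<^sup>2 * (1 + 2 * (1 - \<alpha>)) * 1 / 9"
      by (rule bounds(1)) (use that assms in auto)
    also have "\<dots> = 1 / 9 * (- 2 * \<alpha> ^ 3 + 25 * \<alpha> ^ 2 - 44 * \<alpha> + 30)"
      by (simp add: field_simps power2_eq_square power3_eq_cube)
    finally show ?thesis by (simp only: hg)
  qed
  have "g0 holomorphic_on unit_disc"
    using 0(1) by (simp add: harmonic_decomp_def)
  then have "cmod (toeplitz_det 3 1 g0) \<le> (1 - \<alpha>) / 3"
    by (rule class_K_toeplitz_bounds(2)[OF 0(2) assms(2) max.cobounded1 max.cobounded2 refl])
      (use \<zeta> g0 in auto)
  then show "cmod (toeplitz_det 3 1 g) \<le> 1 / 3 * (1 - \<alpha>)"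
    unfolding hg by simp
next
  assume le: "\<alpha> \<le> 1 / 2"
  \<comment> \<open>For \<open>\<delta> = \<i>\<close> the numbers \<open>- a2\<^sup>2\<close> and \<open>- a3\<close> are positive.\<close>
  interpret extremal_maps \<alpha> \<i>
    by unfold_locales (use assms in auto)
  define b where "b = 1 - \<alpha>"
  have b: "b \<ge> 1 / 2" using le by (simp add: b_def)
  have "toeplitz_det 3 1 (extremal_h \<alpha> \<i>) =
      of_real (1 + 2 * b\<^sup>2 + b\<^sup>2 * (1 + 2 * b) * (4 * b - 1) / 9)"
    unfolding toeplitz_det_extremal b_def[symmetric]
    by (simp add: power_mult_distrib field_simps power2_eq_square)
  also have "1 + 2 * b\<^sup>2 + b\<^sup>2 * (1 + 2 * b) * (4 * b - 1) / 9 =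
      1 / 9 * (8 * \<alpha> ^ 4 - 34 * \<alpha> ^ 3 + 71 * \<alpha> ^ 2 - 72 * \<alpha> + 36)"
    by (simp add: b_def field_simps power2_eq_square power3_eq_cube power4_eq_xxxx)
  finally have "cmod (toeplitz_det 3 1 (extremal_h \<alpha> \<i>)) =
      \<bar>1 / 9 * (8 * \<alpha> ^ 4 - 34 * \<alpha> ^ 3 + 71 * \<alpha> ^ 2 - 72 * \<alpha> + 36)\<bar>"
    by (simp only: norm_of_real)
  moreover have "0 \<le> 1 / 9 * (8 * \<alpha> ^ 4 - 34 * \<alpha> ^ 3 + 71 * \<alpha> ^ 2 - 72 * \<alpha> + 36)"
  proof -
    have "0 \<le> 1 + 2 * b\<^sup>2 + b\<^sup>2 * (1 + 2 * b) * (4 * b - 1) / 9"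
      using b by (intro add_nonneg_nonneg divide_nonneg_nonneg mult_nonneg_nonneg) auto
    also have "\<dots> = 1 / 9 * (8 * \<alpha> ^ 4 - 34 * \<alpha> ^ 3 + 71 * \<alpha> ^ 2 - 72 * \<alpha> + 36)"
      by (simp add: b_def field_simps power2_eq_square power3_eq_cube power4_eq_xxxx)
    finally show ?thesis .
  qed
  ultimately have eq: "cmod (toeplitz_det 3 1 (extremal_h \<alpha> \<i>)) =
      1 / 9 * (8 * \<alpha> ^ 4 - 34 * \<alpha> ^ 3 + 71 * \<alpha> ^ 2 - 72 * \<alpha> + 36)"
    by (simp only: abs_of_nonneg)
  show "\<exists>\<delta>. cmod \<delta> = 1 \<and>
      (\<forall>\<zeta>. cmod \<zeta> \<le> 1 \<longrightarrow>
        (\<exists>f \<in> class_M1 \<alpha> \<zeta>. harmonic_decomp f (extremal_h \<alpha> \<delta>) (extremal_g \<alpha> \<zeta> \<delta>))) \<and>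
      cmod (toeplitz_det 3 1 (extremal_h \<alpha> \<delta>))
        = 1 / 9 * (8 * \<alpha> ^ 4 - 34 * \<alpha> ^ 3 + 71 * \<alpha> ^ 2 - 72 * \<alpha> + 36)"
    by (intro exI[of _ \<i>] conjI allI impI) (fact norm_ii extremal_in_class_M1 eq)+
next
  interpret extremal_maps \<alpha> 1
    by unfold_locales (use assms in auto)
  have "toeplitz_det 3 1 (extremal_g \<alpha> 1 1) = of_real (1 / 3 * (1 - \<alpha>))"
    unfolding toeplitz_det_extremal by simp
  then have "cmod (toeplitz_det 3 1 (extremal_g \<alpha> 1 1)) = \<bar>1 / 3 * (1 - \<alpha>)\<bar>"
    by (simp only: norm_of_real)
  also have "\<dots> = 1 / 3 * (1 - \<alpha>)"
    using assms by simp
  finally have eq: "cmod (toeplitz_det 3 1 (extremal_g \<alpha> 1 1)) = 1 / 3 * (1 - \<alpha>)" .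
  have mem: "\<exists>f \<in> class_M1 \<alpha> 1. harmonic_decomp f (extremal_h \<alpha> 1) (extremal_g \<alpha> 1 1)"
    by (rule extremal_in_class_M1) simp
  show "\<exists>\<delta> \<zeta>. cmod \<delta> = 1 \<and> cmod \<zeta> \<le> 1 \<and>
      (\<exists>f \<in> class_M1 \<alpha> \<zeta>. harmonic_decomp f (extremal_h \<alpha> \<delta>) (extremal_g \<alpha> \<zeta> \<delta>)) \<and>
      cmod (toeplitz_det 3 1 (extremal_g \<alpha> \<zeta> \<delta>)) = 1 / 3 * (1 - \<alpha>)"
    by (rule exI[of _ 1], rule exI[of _ 1], intro conjI) (fact norm_one eq_refl[OF norm_one] mem eq)+
qed

end
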